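(* Let $r$, $s$ and $k$ be positive integers and let $\tau\in[3]^{r+s+1}$ be the template consisting of $r$ copies of $1$, followed by $s$ copies of $2$, followed by one $3$. Then there exist positive integers $n$ and $d$ such that whenever $[3]^n$ is $k$-coloured it contains a monochromatic block set of degree $d$ with template $\tau$.
   Context: $[N]=\{1,\dots,N\}$. A template over $[m]$ is a non-decreasing word $\tau\in[m]^\ell$. For $j\in[m]$ let $c_j=|\{i\in[\ell]:\tau_i=j\}|$; the set of rearrangements of $\tau$ is $S=\{\pi\in[m]^\ell: |\{i:\pi_i=j\}|=c_j\ \forall j\in[m]\}$. A block set with template $\tau$ in $[m]^n$ is a set $B$ formed as follows: choose pairwise disjoint (possibly empty) subsets $I_1,\dots,I_\ell\subset[n]$ (the blocks) and elements $a_i\in[m]$ for $i\notin\bigcup_j I_j$; for $\pi\in S$ define $a^\pi\in[m]^n$ by $(a^\pi)_i=\pi_j$ if $i\in I_j$ and $(a^\pi)_i=a_i$ otherwise; $B=\{a^\pi:\pi\in S\}$. Its degree is $\sum_{j}|I_j|$. A $k$-colouring is a map to a $k$-element set; a set is monochromatic if the colouring is constant on it. *)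

theory Defs
  imports Main "HOL-Library.FuncSet" "HOL-Library.Disjoint_Sets"
begin

text \<open>Words are 1-indexed: an element of \<open>[m]^n\<close> is an extensional function on \<open>{1..n}\<close>
  with values in \<open>{1..m}\<close>.\<close>

definition words :: "nat \<Rightarrow> nat \<Rightarrow> (nat \<Rightarrow> nat) set" where
  "words m n = ({1..n} \<rightarrow>\<^sub>E {1..m})"

definition is_template :: "nat \<Rightarrow> nat \<Rightarrow> (nat \<Rightarrow> nat) \<Rightarrow> bool" where
  "is_template m l \<tau> \<longleftrightarrow> \<tau> \<in> words m l \<and> mono_on {1..l} \<tau>"

definition rearrangements :: "nat \<Rightarrow> nat \<Rightarrow> (nat \<Rightarrow> nat) \<Rightarrow> (nat \<Rightarrow> nat) set" where
  "rearrangements m l \<tau> =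
     {\<pi> \<in> words m l. \<forall>j\<in>{1..m}. card {i\<in>{1..l}. \<pi> i = j} = card {i\<in>{1..l}. \<tau> i = j}}"

text \<open>The word \<open>a\<^sup>\<pi>\<close>. The description \<open>THE j\<close> is meaningful because
  the blocks are required to be pairwise disjoint wherever this is used.\<close>

definition block_word ::
    "nat \<Rightarrow> nat \<Rightarrow> (nat \<Rightarrow> nat set) \<Rightarrow> (nat \<Rightarrow> nat) \<Rightarrow> (nat \<Rightarrow> nat) \<Rightarrow> (nat \<Rightarrow> nat)" where
  "block_word n l I a \<pi> =
     (\<lambda>i\<in>{1..n}. if i \<in> (\<Union>j\<in>{1..l}. I j) then \<pi> (THE j. j \<in> {1..l} \<and> i \<in> I j) else a i)"

text \<open>The degree \<open>d\<close> is part of the predicate because it is read off from the blocks rather than from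
  the set \<open>B\<close>; for a constant template the same \<open>B\<close> arises from blocks of different total size.\<close>

definition is_block_set ::
    "nat \<Rightarrow> nat \<Rightarrow> (nat \<Rightarrow> nat) \<Rightarrow> nat \<Rightarrow> nat \<Rightarrow> (nat \<Rightarrow> nat) set \<Rightarrow> bool" where
  "is_block_set m l \<tau> n d B \<longleftrightarrow>
     is_template m l \<tau> \<and>
     (\<exists>I a. (\<forall>j\<in>{1..l}. I j \<subseteq> {1..n}) \<and>
            disjoint_family_on I {1..l} \<and>
            (\<forall>i\<in>{1..n} - (\<Union>j\<in>{1..l}. I j). a i \<in> {1..m}) \<and>
            (\<Sum>j\<in>{1..l}. card (I j)) = d \<and>
            B = block_word n l I a ` rearrangements m l \<tau>)"

definition monochromatic :: "('a \<Rightarrow> 'c) \<Rightarrow> 'a set \<Rightarrow> bool" where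
  "monochromatic c B \<longleftrightarrow> (\<forall>x\<in>B. \<forall>y\<in>B. c x = c y)"

definition template_123 :: "nat \<Rightarrow> nat \<Rightarrow> (nat \<Rightarrow> nat)" where
  "template_123 r s = (\<lambda>i\<in>{1..r+s+1}. if i \<le> r then 1 else if i \<le> r + s then 2 else 3)"

lemma is_template_123: "is_template 3 (r + s + 1) (template_123 r s)"
  unfolding is_template_def words_def template_123_def
  by (auto simp: mono_on_def)

end

theory Submission
  imports Defs "HOL-Library.Ramsey"
begin

text \<open>
  Consider words of \<open>[3]^n\<close> with exactly \<open>t\<close> letters different from 1. Ramsey's theorem for
  \<open>t\<close>-sets gives many coordinates on which the colour depends only on the pattern of 2s and 3s,
  that is, on the set of ranks of the 3s among the non-1s. Ramsey's theorem for \<open>d\<close>-sets,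
  applied to the whole vector of colours of the translates of a rank set by \<open>0, \<dots>, W\<close>, then
  gives a sparse set of ranks such that the colour of any \<open>d\<close> of them, translated by \<open>x\<close>,
  depends on \<open>x\<close> alone. Van der Waerden's theorem yields \<open>s + 1\<close> translations
  \<open>x0, x0 + p, \<dots>, x0 + s * p\<close> of the same colour. As \<open>W\<close> does not depend on \<open>d\<close>, one may take
  \<open>d = W!\<close>, so that \<open>p\<close> divides \<open>d\<close>.

  Each of the \<open>r + s + 1\<close> blocks has size \<open>d\<close> and is cut into \<open>e = d / p\<close> pieces of size \<open>p\<close>;
  the first pieces of all blocks come first, in the order of the blocks, then the second pieces,
  and so on, with fixed 2s in between. If block \<open>j\<close> carries the 3s and \<open>a\<close> of the blocks before
  it carry 2s, then the ranks of the 3s are translated by \<open>x0 + a * p\<close>, because every completed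
  round contributes the same number of non-1s.
\<close>

hide_const (open) Ramsey.monochromatic

section \<open>Van der Waerden's theorem by colour focusing\<close>

definition mono_ap :: "(nat \<Rightarrow> 'a) \<Rightarrow> nat \<Rightarrow> nat \<Rightarrow> nat \<Rightarrow> bool" where
  "mono_ap c l a p \<longleftrightarrow> p > 0 \<and> (\<forall>i\<le>l. c (a + i * p) = c a)"

text \<open>The focus \<open>f\<close> is the term that would come next in each of the
  \<open>j\<close> progressions. Their colours differ, so the colour of \<open>f\<close> either
  prolongs one of them or is new.\<close>

definition focused_aps :: "(nat \<Rightarrow> 'a) \<Rightarrow> nat \<Rightarrow> nat \<Rightarrow> nat \<Rightarrow> (nat \<Rightarrow> nat) \<Rightarrow> (nat \<Rightarrow> nat) \<Rightarrow> bool" where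
  "focused_aps c l f j A D \<longleftrightarrow>
     (\<forall>i<j. mono_ap c l (A i) (D i) \<and> A i + Suc l * D i = f) \<and> inj_on (\<lambda>i. c (A i)) {..<j}"

text \<open>Induction on \<open>j\<close>. Cut the numbers into intervals of length \<open>N\<close>
  and colour each interval by its whole pattern; the assumption gives equally spaced intervals with
  the same pattern. Focused progressions inside the first one, with differences enlarged by the
  spacing, stay monochromatic, and the copies of their focus form one more progression. The bound
  \<open>p \<le> W\<close> has to be demanded separately because \<open>a + l * p < W\<close> says
  nothing about \<open>p\<close> when \<open>l = 0\<close>.\<close>

lemma color_focusing:
  assumes vdW: "\<And>k. \<exists>W. \<forall>c :: nat \<Rightarrow> nat. (\<forall>x. c x < k) \<longrightarrow> (\<exists>a p. a + l * p < W \<and> p \<le> W \<and> mono_ap c l a p)"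
  shows "\<exists>N. \<forall>c :: nat \<Rightarrow> nat. (\<forall>x. c x < k) \<longrightarrow>
           (\<exists>a p. a + Suc l * p < N \<and> mono_ap c (Suc l) a p) \<or> (\<exists>f<N. \<exists>A D. focused_aps c l f j A D)"
proof (induction j)
  case 0
  show ?case by (rule exI[of _ 1]) (auto simp: focused_aps_def)
next
  case (Suc j)
  then obtain N where N: "\<And>c :: nat \<Rightarrow> nat. (\<And>x. c x < k) \<Longrightarrow>
      (\<exists>a p. a + Suc l * p < N \<and> mono_ap c (Suc l) a p) \<or> (\<exists>f<N. \<exists>A D. focused_aps c l f j A D)"
    by blast
  define P where "P = ({..<N} \<rightarrow>\<^sub>E {..<k})"
  have "finite P" unfolding P_def by (intro finite_PiE) auto
  then obtain e where e: "bij_betw e P {0..<card P}"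
    using ex_bij_betw_finite_nat by blast
  obtain W where W: "\<And>c :: nat \<Rightarrow> nat. (\<And>x. c x < card P) \<Longrightarrow>
      \<exists>a p. a + l * p < W \<and> p \<le> W \<and> mono_ap c l a p"
    using vdW[of "card P"] by blast
  show ?case
  \<comment> \<open>The new focus lies one step beyond the last interval, and
    \<open>a + l * p < W\<close> with \<open>p \<le> W\<close> gives
    \<open>a + Suc l * p + 1 \<le> 2 * W\<close>.\<close>
  proof (rule exI[of _ "2 * W * N"], intro allI impI)
    fix c :: "nat \<Rightarrow> nat"
    assume c: "\<forall>x. c x < k"
    define b where "b y = (\<lambda>i\<in>{..<N}. c (y * N + i))" for y
    have bP: "b y \<in> P" for y using c by (auto simp: b_def P_def)
    have "e (b y) < card P" for y using bij_betwE[OF e] bP by auto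
    then obtain a p where ap: "a + l * p < W" "p \<le> W" "mono_ap (\<lambda>y. e (b y)) l a p"
      using W[of "\<lambda>y. e (b y)"] by blast
    have "b (a + i * p) = b a" if "i \<le> l" for i
      using ap(3) that inj_onD[OF bij_betw_imp_inj_on[OF e] _ bP bP] by (auto simp: mono_ap_def)
    then have blocks: "c ((a + i * p) * N + t) = c (a * N + t)" if "i \<le> l" "t < N" for i t
    proof -
      have "b (a + i * p) t = b a t" using \<open>\<And>i. i \<le> l \<Longrightarrow> b (a + i * p) = b a\<close> that by simp
      then show ?thesis using that by (simp add: b_def)
    qed
    have p0: "p > 0" using ap(3) by (simp add: mono_ap_def)
    define c' where "c' x = c (a * N + x)" for x
    have lift: "\<exists>a p. a + Suc l * p < 2 * W * N \<and> mono_ap c (Suc l) a p"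
      if "a' + Suc l * p' < N" "mono_ap c' (Suc l) a' p'" for a' p'
    proof (rule exI[of _ "a * N + a'"], rule exI[of _ p'], rule conjI)
      have "a * N + a' + Suc l * p' < (a + 1) * N" using that(1) by simp
      also have "\<dots> \<le> (2 * W) * N" using ap(1) by (intro mult_right_mono) auto
      finally show "a * N + a' + Suc l * p' < 2 * W * N" .
      show "mono_ap c (Suc l) (a * N + a') p'"
        using that(2) by (simp add: mono_ap_def c'_def add.assoc)
    qed
    show "(\<exists>a p. a + Suc l * p < 2 * W * N \<and> mono_ap c (Suc l) a p) \<or>
          (\<exists>f<2 * W * N. \<exists>A D. focused_aps c l f (Suc j) A D)"
    proof (cases "\<exists>a p. a + Suc l * p < N \<and> mono_ap c' (Suc l) a p")
      case True
      then show ?thesis using lift by blast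
    next
      case False
      then obtain f A D where f: "f < N" and foc: "focused_aps c' l f j A D"
        using N[of c'] c by (auto simp: c'_def)
      \<comment> \<open>Otherwise the focus would prolong the \<open>i\<close>-th progression, which
        the case assumption excludes.\<close>
      have ne: "c' (A i) \<noteq> c' f" if "i < j" for i
      proof
        assume eq: "c' (A i) = c' f"
        have "mono_ap c' (Suc l) (A i) (D i)"
          using foc that eq by (auto simp: focused_aps_def mono_ap_def le_Suc_eq)
        moreover have "A i + Suc l * D i < N" using foc that f by (auto simp: focused_aps_def)
        ultimately show False using False by blast
      qed
      define A' where "A' i = a * N + (if i < j then A i else f)" for i
      define D' where "D' i = (if i < j then D i else 0) + p * N" for i
      have col: "c (A' i + x * D' i) = c (A' i)" if "i < Suc j" "x \<le> l" for i x
      proof (cases "i < j")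
        case True
        have "x * D i \<le> Suc l * D i" using that by (intro mult_right_mono) auto
        then have lt: "A i + x * D i < N" "A i < N" using foc True f by (auto simp: focused_aps_def)
        have "c (A' i + x * D' i) = c ((a + x * p) * N + (A i + x * D i))"
          using True by (simp add: A'_def D'_def algebra_simps)
        also have "\<dots> = c' (A i + x * D i)" using blocks lt that by (simp add: c'_def)
        also have "\<dots> = c' (A i)" using foc True that by (auto simp: focused_aps_def mono_ap_def)
        finally show ?thesis using True by (simp add: A'_def c'_def)
      next
        case False
        have "c (A' i + x * D' i) = c ((a + x * p) * N + f)"
          using False by (simp add: A'_def D'_def algebra_simps)
        also have "\<dots> = c (a * N + f)" using blocks f that by simp
        finally show ?thesis using False by (simp add: A'_def)
      qed
      have "focused_aps c l ((a + Suc l * p) * N + f) (Suc j) A' D'"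
        unfolding focused_aps_def
      proof (intro conjI allI impI)
        fix i assume i: "i < Suc j"
        show "mono_ap c l (A' i) (D' i)"
          using col[OF i] p0 f by (auto simp: mono_ap_def D'_def)
        show "A' i + Suc l * D' i = (a + Suc l * p) * N + f"
          using foc i by (auto simp: A'_def D'_def focused_aps_def algebra_simps)
      next
        have "c (A' i) = (if i < j then c' (A i) else c' f)" for i
          by (simp add: A'_def c'_def)
        then show "inj_on (\<lambda>i. c (A' i)) {..<Suc j}"
          using foc ne ne[symmetric] by (auto simp: focused_aps_def inj_on_def less_Suc_eq)
      qed
      moreover have "(a + Suc l * p) * N + f < 2 * W * N"
      proof -
        have "(a + Suc l * p) * N + f < (a + Suc l * p + 1) * N" using f by simp
        also have "\<dots> \<le> (2 * W) * N" using ap by (intro mult_right_mono) auto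
        finally show ?thesis .
      qed
      ultimately show ?thesis by blast
    qed
  qed
qed

text \<open>Apply focusing with \<open>j = k + 1\<close>: that many focused progressions would need
  \<open>k + 1\<close> distinct colours, so only the long progression remains.\<close>

lemma van_der_Waerden_nat:
  "\<exists>W. \<forall>c :: nat \<Rightarrow> nat. (\<forall>x. c x < k) \<longrightarrow> (\<exists>a p. a + l * p < W \<and> p \<le> W \<and> mono_ap c l a p)"
proof (induction l arbitrary: k)
  case 0
  show ?case by (rule exI[of _ 1]) (auto simp: mono_ap_def intro!: exI[of _ 0] exI[of _ 1])
next
  case (Suc l)
  obtain N where N: "\<And>c :: nat \<Rightarrow> nat. (\<And>x. c x < k) \<Longrightarrow>
      (\<exists>a p. a + Suc l * p < N \<and> mono_ap c (Suc l) a p) \<or> (\<exists>f<N. \<exists>A D. focused_aps c l f (Suc k) A D)"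
    using color_focusing[OF Suc, of k "Suc k"] by blast
  show ?case
  proof (rule exI[of _ N], intro allI impI)
    fix c :: "nat \<Rightarrow> nat"
    assume c: "\<forall>x. c x < k"
    have "\<not> focused_aps c l f (Suc k) A D" for f A D
    proof
      assume "focused_aps c l f (Suc k) A D"
      then have "card {..<Suc k} \<le> card {..<k}"
        using c by (intro card_inj_on_le[of "\<lambda>i. c (A i)"]) (auto simp: focused_aps_def)
      then show False by simp
    qed
    then obtain a p where "a + Suc l * p < N" "mono_ap c (Suc l) a p"
      using N[of c] c by blast
    then show "\<exists>a p. a + Suc l * p < N \<and> p \<le> N \<and> mono_ap c (Suc l) a p"
      by (intro exI[of _ a] exI[of _ p]) auto
  qed
qed

theorem van_der_Waerden:
  fixes C :: "'a set"
  assumes "finite C"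
  shows "\<exists>W. \<forall>c. c ` {..<W} \<subseteq> C \<longrightarrow> (\<exists>a p. a + l * p < W \<and> p \<le> W \<and> mono_ap c l a p)"
proof -
  obtain e :: "'a \<Rightarrow> nat" where e: "bij_betw e C {0..<card C}"
    using ex_bij_betw_finite_nat[OF assms] by blast
  obtain W where W: "\<And>c :: nat \<Rightarrow> nat. (\<And>x. c x < card C) \<Longrightarrow>
      \<exists>a p. a + l * p < W \<and> p \<le> W \<and> mono_ap c l a p"
    using van_der_Waerden_nat[of "card C" l] by blast
  show ?thesis
  proof (rule exI[of _ "Suc W"], intro allI impI)
    fix c :: "nat \<Rightarrow> 'a"
    assume c: "c ` {..<Suc W} \<subseteq> C"
    \<comment> \<open>Truncation at \<open>W\<close> extends the colouring of an initial segment to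
      all numbers; the bound \<open>Suc W\<close> keeps \<open>W\<close> itself coloured.\<close>
    define g where "g x = e (c (min x W))" for x
    have inC: "c (min x W) \<in> C" for x using c by auto
    then have "g x < card C" for x using bij_betwE[OF e] by (auto simp: g_def)
    then obtain a p where ap: "a + l * p < W" "p \<le> W" "mono_ap g l a p"
      using W[of g] by blast
    have "c (a + i * p) = c a" if "i \<le> l" for i
    proof -
      have "i * p \<le> l * p" using that by simp
      then have "a + i * p < W" using ap(1) by linarith
      then have m: "min (a + i * p) W = a + i * p" "min a W = a" by auto
      have "g (a + i * p) = g a" using ap(3) that by (simp add: mono_ap_def)
      then show ?thesis
        using inj_onD[OF bij_betw_imp_inj_on[OF e] _ inC inC] m unfolding g_def by metis
    qed
    then show "\<exists>a p. a + l * p < Suc W \<and> p \<le> Suc W \<and> mono_ap c l a p"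
      using ap by (intro exI[of _ a] exI[of _ p]) (auto simp: mono_ap_def)
  qed
qed

section \<open>Ramsey's theorem and its two applications\<close>

text \<open>The colours form an arbitrary finite set because both applications colour by whole
  functions.\<close>

lemma finite_Ramsey:
  fixes C :: "'a set"
  assumes "finite C"
  shows "\<exists>N :: nat. \<forall>f. f ` [{..<N}]\<^bsup>r\<^esup> \<subseteq> C \<longrightarrow>
           (\<exists>H\<subseteq>{..<N}. card H = h \<and> (\<exists>i. \<forall>X\<in>[H]\<^bsup>r\<^esup>. f X = i))"
proof -
  obtain e :: "'a \<Rightarrow> nat" where e: "bij_betw e C {0..<card C}"
    using ex_bij_betw_finite_nat[OF assms] by blast
  obtain N :: nat where N: "partn_lst {..<N} (replicate (card C) h) r"
    using ramsey_full[of "replicate (card C) h" r] by blast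
  show ?thesis
  proof (rule exI[of _ N], intro allI impI)
    fix f :: "nat set \<Rightarrow> 'a"
    assume f: "f ` [{..<N}]\<^bsup>r\<^esup> \<subseteq> C"
    have "(\<lambda>X. e (f X)) \<in> [{..<N}]\<^bsup>r\<^esup> \<rightarrow> {..<card C}"
      using f bij_betwE[OF e] by fastforce
    then obtain i H where i: "i < card C" and H: "H \<in> [{..<N}]\<^bsup>h\<^esup>"
      and mono: "(\<lambda>X. e (f X)) ` [H]\<^bsup>r\<^esup> \<subseteq> {i}"
      using partn_lstE[OF N, of "\<lambda>X. e (f X)" "card C"] by auto
    have "f X = inv_into C e i" if "X \<in> [H]\<^bsup>r\<^esup>" for X
    proof -
      have "X \<in> [{..<N}]\<^bsup>r\<^esup>" using that H by (auto simp: nsets_def)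
      then have "f X \<in> C" using f by blast
      moreover have "e (f X) = i" using mono that by blast
      ultimately show ?thesis using e by (metis bij_betw_inv_into_left)
    qed
    then show "\<exists>H\<subseteq>{..<N}. card H = h \<and> (\<exists>i. \<forall>X\<in>[H]\<^bsup>r\<^esup>. f X = i)"
      using H by (auto simp: nsets_def)
  qed
qed

definition rank :: "nat set \<Rightarrow> nat \<Rightarrow> nat" where
  "rank A x = card {a \<in> A. a < x}"

lemma rank_strict_mono:
  assumes "finite A" "x \<in> A" "x < y"
  shows "rank A x < rank A y"
  unfolding rank_def using assms by (intro psubset_card_mono) auto

lemma inj_on_rank: "finite A \<Longrightarrow> inj_on (rank A) A"
  by (rule linorder_inj_onI) (use rank_strict_mono in \<open>auto simp: less_imp_neq\<close>)

lemma rank_less_card: "finite A \<Longrightarrow> x \<in> A \<Longrightarrow> rank A x < card A"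
  unfolding rank_def by (intro psubset_card_mono) auto

lemma rank_image:
  assumes "strict_mono_on H g" "A \<subseteq> H" "x \<in> H"
  shows "rank (g ` A) (g x) = rank A x"
proof -
  have "{a \<in> g ` A. a < g x} = g ` {a \<in> A. a < x}"
    using assms by (auto simp: strict_mono_on_less)
  moreover have "inj_on g {a \<in> A. a < x}"
    using assms strict_mono_on_imp_inj_on by (metis (no_types, lifting) inj_on_subset mem_Collect_eq subsetI)
  ultimately show ?thesis by (simp add: rank_def card_image)
qed

text \<open>In use \<open>B\<close> is a subset of \<open>A\<close>, so that \<open>A\<close> holds
  all non-1s and \<open>B\<close> the 3s among them.\<close>

definition word123 :: "nat \<Rightarrow> nat set \<Rightarrow> nat set \<Rightarrow> nat \<Rightarrow> nat" where
  "word123 n A B = (\<lambda>x\<in>{1..n}. if x \<in> B then 3 else if x \<in> A then 2 else 1)"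

lemma word123_in_words: "word123 n A B \<in> words 3 n"
  by (auto simp: word123_def words_def)

text \<open>Colour a \<open>t\<close>-set \<open>X\<close> by the function that takes a set of ranks
  to the colour of the word with non-1s on \<open>X\<close> and 3s at these ranks. On a homogeneous
  set this function is constant, and its increasing enumeration \<open>g\<close> preserves
  ranks.\<close>

lemma pattern_Ramsey:
  fixes C :: "'a set" and t h :: nat
  assumes "finite C" "t \<le> h"
  shows "\<exists>n>0. \<forall>c \<in> words 3 n \<rightarrow> C. \<exists>g F. strict_mono_on {..<h} g \<and> g ` {..<h} \<subseteq> {1..n} \<and>
           F ` Pow {..<t} \<subseteq> C \<and>
           (\<forall>A\<subseteq>{..<h}. card A = t \<longrightarrow> (\<forall>B\<subseteq>A. c (word123 n (g ` A) (g ` B)) = F (rank A ` B)))"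
proof -
  have "finite (Pow {..<t} \<rightarrow>\<^sub>E C)" using assms by (intro finite_PiE) auto
  from finite_Ramsey[OF this, of t h] obtain N :: nat where
    N: "\<And>f :: nat set \<Rightarrow> _. f ` [{..<N}]\<^bsup>t\<^esup> \<subseteq> (Pow {..<t} \<rightarrow>\<^sub>E C) \<Longrightarrow>
          \<exists>H\<subseteq>{..<N}. card H = h \<and> (\<exists>i. \<forall>X\<in>[H]\<^bsup>t\<^esup>. f X = i)"
    by blast
  show ?thesis
  \<comment> \<open>Coordinates start at 1, so vertices are shifted by \<open>Suc\<close>; the
    choice \<open>Suc N\<close> also makes \<open>n\<close> positive.\<close>
  proof (rule exI[of _ "Suc N"], intro conjI ballI)
    fix c assume c: "c \<in> words 3 (Suc N) \<rightarrow> C"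
    define f where "f X = (\<lambda>Z\<in>Pow {..<t}. c (word123 (Suc N) (Suc ` X) (Suc ` {x \<in> X. rank X x \<in> Z})))" for X
    have fC: "f X \<in> Pow {..<t} \<rightarrow>\<^sub>E C" for X
      using c word123_in_words by (auto simp: f_def)
    then obtain H i where H: "H \<subseteq> {..<N}" "card H = h" and i: "\<And>X. X \<in> [H]\<^bsup>t\<^esup> \<Longrightarrow> f X = i"
      using N[of f] by blast
    have finH: "finite H" using H finite_subset by blast
    obtain g where g: "bij_betw g {..<h} H" "strict_mono_on {..<h} g"
      using ex_bij_betw_strict_mono_card[OF finH] H(2) by blast
    have gX: "g ` A \<in> [H]\<^bsup>t\<^esup>" if "A \<subseteq> {..<h}" "card A = t" for A
      using that g(1) card_image[of g A] inj_on_subset[of g "{..<h}" A] finite_subset[OF that(1)]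
      by (auto simp: nsets_def bij_betw_def)
    \<comment> \<open>As \<open>t \<le> h\<close>, a \<open>t\<close>-subset exists, so the common
      value really is a function into \<open>C\<close>.\<close>
    have "i \<in> Pow {..<t} \<rightarrow>\<^sub>E C"
      using i[OF gX[of "{..<t}"]] fC assms by auto
    moreover have "c (word123 (Suc N) ((\<lambda>x. Suc (g x)) ` A) ((\<lambda>x. Suc (g x)) ` B)) = i (rank A ` B)"
      if A: "A \<subseteq> {..<h}" "card A = t" and B: "B \<subseteq> A" for A B
    proof -
      have finA: "finite A" using A finite_subset by blast
      have Z: "rank A ` B \<in> Pow {..<t}" using B rank_less_card[OF finA] A by auto
      have "rank (g ` A) (g x) \<in> rank A ` B \<longleftrightarrow> x \<in> B" if "x \<in> A" for x
        using rank_image[OF g(2) A(1), of x] that A B inj_on_rank[OF finA]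
        by (metis inj_on_image_mem_iff subsetD)
      then have "{x \<in> g ` A. rank (g ` A) x \<in> rank A ` B} = g ` B"
        using B by auto
      then have "f (g ` A) (rank A ` B) = c (word123 (Suc N) (Suc ` g ` A) (Suc ` g ` B))"
        using Z by (simp add: f_def)
      then show ?thesis using i[OF gX[OF A]] by (simp add: image_image)
    qed
    moreover have "strict_mono_on {..<h} (\<lambda>x. Suc (g x))"
      using g(2) by (auto simp: strict_mono_on_def)
    moreover have "(\<lambda>x. Suc (g x)) ` {..<h} \<subseteq> {1..Suc N}"
      using g(1) H(1) by (fastforce simp: bij_betw_def)
    ultimately show "\<exists>g F. strict_mono_on {..<h} g \<and> g ` {..<h} \<subseteq> {1..Suc N} \<and>
           F ` Pow {..<t} \<subseteq> C \<and>
           (\<forall>A\<subseteq>{..<h}. card A = t \<longrightarrow>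
              (\<forall>B\<subseteq>A. c (word123 (Suc N) (g ` A) (g ` B)) = F (rank A ` B)))"
      by (intro exI[of _ "\<lambda>x. Suc (g x)"] exI[of _ i]) auto
  qed simp
qed

text \<open>Colour a \<open>d\<close>-set by the vector of the \<open>F\<close>-values of all
  translates of its dilate by \<open>K\<close>. Homogeneity makes every entry independent of the
  set, leaving a colouring \<open>G\<close> of the translations alone.\<close>

lemma translation_Ramsey:
  fixes C :: "'a set" and d h K m :: nat
  assumes "finite C" "d \<le> h" "K > 0"
  shows "\<exists>N. \<forall>F. F ` Pow {..<K * N + m} \<subseteq> C \<longrightarrow>
           (\<exists>M\<subseteq>{..<N}. card M = h \<and> (\<exists>G. G ` {..m} \<subseteq> C \<and>
             (\<forall>Y\<subseteq>M. card Y = d \<longrightarrow> (\<forall>x\<le>m. F ((\<lambda>y. K * y + x) ` Y) = G x))))"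
proof -
  have "finite ({..m} \<rightarrow>\<^sub>E C)" using assms by (intro finite_PiE) auto
  from finite_Ramsey[OF this, of d h] obtain N :: nat where
    N: "\<And>f :: nat set \<Rightarrow> _. f ` [{..<N}]\<^bsup>d\<^esup> \<subseteq> ({..m} \<rightarrow>\<^sub>E C) \<Longrightarrow>
          \<exists>H\<subseteq>{..<N}. card H = h \<and> (\<exists>i. \<forall>X\<in>[H]\<^bsup>d\<^esup>. f X = i)"
    by blast
  show ?thesis
  proof (rule exI[of _ N], intro allI impI)
    fix F :: "nat set \<Rightarrow> 'a"
    assume F: "F ` Pow {..<K * N + m} \<subseteq> C"
    define f where "f Y = (\<lambda>x\<in>{..m}. F ((\<lambda>y. K * y + x) ` Y))" for Y
    have fC: "f Y \<in> {..m} \<rightarrow>\<^sub>E C" if "Y \<subseteq> {..<N}" for Y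
    proof -
      have "K * y + x < K * N + m" if "y \<in> Y" "x \<le> m" for x y
        using that \<open>Y \<subseteq> {..<N}\<close> \<open>K > 0\<close> by (intro add_less_le_mono) auto
      then show ?thesis using F by (auto simp: f_def image_subset_iff)
    qed
    have "f ` [{..<N}]\<^bsup>d\<^esup> \<subseteq> ({..m} \<rightarrow>\<^sub>E C)"
    proof
      fix z assume "z \<in> f ` [{..<N}]\<^bsup>d\<^esup>"
      then obtain Y where "Y \<subseteq> {..<N}" "z = f Y" by (auto simp: nsets_def)
      then show "z \<in> {..m} \<rightarrow>\<^sub>E C" using fC by simp
    qed
    from N[OF this] obtain M G where M: "M \<subseteq> {..<N}" "card M = h" and G: "\<And>Y. Y \<in> [M]\<^bsup>d\<^esup> \<Longrightarrow> f Y = G"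
      by blast
    have YM: "Y \<in> [M]\<^bsup>d\<^esup>" if "Y \<subseteq> M" "card Y = d" for Y
      using that finite_subset[OF order_trans[OF that(1) M(1)]] by (simp add: nsets_def)
    obtain Y where Y: "Y \<subseteq> M" "card Y = d"
      using obtain_subset_with_card_n[of d M] assms M by metis
    have "G \<in> {..m} \<rightarrow>\<^sub>E C" using G[OF YM[OF Y]] fC Y M by blast
    moreover have "F ((\<lambda>y. K * y + x) ` Y) = G x" if "Y \<subseteq> M" "card Y = d" "x \<le> m" for Y x
      using fun_cong[OF G[OF YM], of Y x] that by (simp add: f_def)
    ultimately show "\<exists>M\<subseteq>{..<N}. card M = h \<and> (\<exists>G. G ` {..m} \<subseteq> C \<and>
             (\<forall>Y\<subseteq>M. card Y = d \<longrightarrow> (\<forall>x\<le>m. F ((\<lambda>y. K * y + x) ` Y) = G x)))"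
      using M by (intro exI[of _ M] conjI exI[of _ G]) auto
  qed
qed

section \<open>Interleaved blocks and the ranks of their elements\<close>

text \<open>
  A triple \<open>(u, j, i)\<close> is the \<open>i\<close>-th element of the \<open>u\<close>-th piece of block \<open>j\<close>, and \<open>pos\<close> is its place among
  the selected coordinates. The summand \<open>p * (u * r + (j - 1))\<close> is the number of preceding block
  elements that would carry 1s if all blocks before \<open>j\<close> did so in round \<open>u\<close>; the blocks which
  instead carry 2s account for the translation. The spacing \<open>K\<close> keeps \<open>pos\<close> increasing from one
  round to the next, where this summand drops. The multiplier in \<open>index\<close> is \<open>l + 1\<close> because
  \<open>j\<close> starts at 1.
\<close>

locale layout =
  fixes e l p K x0 r :: nat and \<mu> :: "nat \<Rightarrow> nat"
  assumes \<mu>_mono: "strict_mono_on {..<e * Suc l * p} \<mu>"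
    and K_eq: "K = e * p * l + 1"
begin

definition index :: "nat \<times> nat \<times> nat \<Rightarrow> nat" where
  "index = (\<lambda>(u, j, i). (u * Suc l + j) * p + i)"

definition pos :: "nat \<times> nat \<times> nat \<Rightarrow> nat" where
  "pos = (\<lambda>(u, j, i). K * \<mu> (index (u, j, i)) + x0 + p * (u * r + (j - 1)))"

definition block :: "nat \<Rightarrow> (nat \<times> nat \<times> nat) set" where
  "block j = {..<e} \<times> {j} \<times> {..<p}"

lemma index_less:
  assumes "u < e" "j \<le> l" "i < p"
  shows "index (u, j, i) < e * Suc l * p"
proof -
  have "index (u, j, i) < (u * Suc l + j + 1) * p" using assms by (simp add: index_def)
  also have "\<dots> \<le> (Suc u * Suc l) * p" using assms by (intro mult_right_mono) auto
  also have "\<dots> \<le> e * Suc l * p" using assms by (intro mult_right_mono) auto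
  finally show ?thesis .
qed

lemma index_strict_mono:
  assumes "u < u' \<or> u = u' \<and> (j < j' \<or> j = j' \<and> i < i')" "j \<le> l" "i < p"
  shows "index (u, j, i) < index (u', j', i')"
proof (cases "u = u' \<and> j = j'")
  case True
  then show ?thesis using assms by (auto simp: index_def)
next
  case False
  have "u * Suc l + j + 1 \<le> u' * Suc l + j'"
  proof (cases "u = u'")
    case True
    then show ?thesis using assms False by auto
  next
    case False
    have "u * Suc l + j + 1 \<le> Suc u * Suc l" using assms by simp
    also have "\<dots> \<le> u' * Suc l" using assms False by (intro mult_right_mono) auto
    finally show ?thesis by simp
  qed
  then have "(u * Suc l + j + 1) * p \<le> (u' * Suc l + j') * p" by (rule mult_right_mono) simp
  then show ?thesis using assms by (simp add: index_def)
qed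

lemma pos_strict_mono:
  assumes "u < u' \<or> u = u' \<and> (j < j' \<or> j = j' \<and> i < i')"
    and "u' < e" "j \<in> {1..l}" "i < p" "j' \<in> {1..l}" "i' < p"
  shows "pos (u, j, i) < pos (u', j', i')"
proof -
  have "u < e" using assms by auto
  then have "index (u, j, i) < e * Suc l * p" "index (u', j', i') < e * Suc l * p"
    using assms by (auto intro!: index_less simp del: mult_Suc_right)
  moreover have "index (u, j, i) < index (u', j', i')"
    using assms by (intro index_strict_mono) auto
  ultimately have "\<mu> (index (u, j, i)) < \<mu> (index (u', j', i'))"
    by (intro strict_mono_onD[OF \<mu>_mono]) auto
  then have "K * (\<mu> (index (u, j, i)) + 1) \<le> K * \<mu> (index (u', j', i'))"
    by (intro mult_left_mono) auto
  \<comment> \<open>The second summand falls by at most \<open>e * p * l = K - 1\<close>, less than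
    the gain of \<open>K\<close> in the first.\<close>
  moreover have "p * (u * r + (j - 1)) \<le> p * (u' * r + (j' - 1)) + e * p * l"
  proof -
    have "p * (u * r + (j - 1)) \<le> p * (u' * r + l)"
      using assms by (intro mult_left_mono add_mono mult_right_mono) auto
    moreover have "p * (u' * r + l) \<le> p * (u' * r + (j' - 1)) + p * l"
      by (simp add: distrib_left)
    moreover have "1 * (p * l) \<le> e * (p * l)" using assms by (intro mult_right_mono) auto
    ultimately show ?thesis unfolding mult.assoc mult_1 by linarith
  qed
  ultimately show ?thesis
    unfolding pos_def prod.case distrib_left[of K] using K_eq by linarith
qed

lemma inj_on_pos: "inj_on pos ({..<e} \<times> {1..l} \<times> {..<p})"
proof (rule inj_onI)
  fix q q'
  assume q: "q \<in> {..<e} \<times> {1..l} \<times> {..<p}" "q' \<in> {..<e} \<times> {1..l} \<times> {..<p}" and eq: "pos q = pos q'"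
  obtain u j i u' j' i' where "q = (u, j, i)" "q' = (u', j', i')" by (metis prod.exhaust)
  then show "q = q'"
    using pos_strict_mono[of u u' j j' i i'] pos_strict_mono[of u' u j' j i' i] q eq
    by simp (metis less_irrefl linorder_neqE_nat)
qed

text \<open>Every completed round contributes all \<open>r\<close> pieces of \<open>R\<close>, and
  round \<open>u\<close> contributes those of the blocks before \<open>j\<close>; \<open>j\<close>
  itself is not in \<open>R\<close>.\<close>

lemma card_preceding:
  assumes "R \<subseteq> {1..l}" "card R = r" "j \<in> {1..l} - R" "u < e" "i < p"
  shows "card {x \<in> pos ` (\<Union>j\<in>R. block j). x < pos (u, j, i)} = p * (u * r + card {j' \<in> R. j' < j})"
proof -
  let ?Q = "{..<u} \<times> R \<times> {..<p} \<union> {u} \<times> {j' \<in> R. j' < j} \<times> {..<p}"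
  have finR: "finite R" using assms finite_subset by blast
  have "pos (u', j', i') < pos (u, j, i) \<longleftrightarrow> u' < u \<or> u' = u \<and> j' < j"
    if "u' < e" "j' \<in> R" "i' < p" for u' j' i'
  proof -
    have "j' \<noteq> j" "j' \<in> {1..l}" using that assms by auto
    then show ?thesis
      using pos_strict_mono[of u u' j j' i i'] pos_strict_mono[of u' u j' j i' i] that assms
      by (metis Diff_iff linorder_neqE_nat not_less_iff_gr_or_eq)
  qed
  then have "{x \<in> pos ` (\<Union>j\<in>R. block j). x < pos (u, j, i)} = pos ` ?Q"
    using assms by (fastforce simp: block_def)
  moreover have "inj_on pos ?Q"
    using assms by (intro inj_on_subset[OF inj_on_pos]) auto
  moreover have "card ?Q = u * r * p + card {j' \<in> R. j' < j} * p"
    using assms finR by (subst card_Un_disjoint) (auto simp: card_cartesian_product)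
  ultimately show ?thesis by (simp add: card_image algebra_simps)
qed

text \<open>The rank is the position minus the number of deleted earlier positions. The terms
  \<open>p * u * r\<close> cancel, and of the \<open>j - 1\<close> earlier blocks only those outside
  \<open>R\<close> survive, so the translation is the same in every round.\<close>

lemma rank_pos:
  assumes h: "\<forall>q \<in> {..<e} \<times> {1..l} \<times> {..<p}. pos q < h"
    and R: "R \<subseteq> {1..l}" "card R = r" and j: "j \<in> {1..l} - R" and ui: "u < e" "i < p"
  shows "rank ({..<h} - pos ` (\<Union>j\<in>R. block j)) (pos (u, j, i)) =
           K * \<mu> (index (u, j, i)) + (x0 + card {j' \<in> {1..l} - R. j' < j} * p)"
proof -
  let ?O = "{x \<in> pos ` (\<Union>j\<in>R. block j). x < pos (u, j, i)}"
  have "{a \<in> {..<h} - pos ` (\<Union>j\<in>R. block j). a < pos (u, j, i)} = {..<pos (u, j, i)} - ?O"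
    using bspec[OF h, of "(u, j, i)"] j ui by auto
  moreover have "card ({..<pos (u, j, i)} - ?O) = pos (u, j, i) - card ?O"
    by (subst card_Diff_subset) (auto intro: finite_subset[of _ "{..<pos (u, j, i)}"])
  moreover have b: "j - 1 = card {j' \<in> R. j' < j} + card {j' \<in> {1..l} - R. j' < j}"
  proof -
    have "{1..<j} = {j' \<in> R. j' < j} \<union> {j' \<in> {1..l} - R. j' < j}" using R j by auto
    then have "card {1..<j} = card \<dots>" by simp
    also have "\<dots> = card {j' \<in> R. j' < j} + card {j' \<in> {1..l} - R. j' < j}"
      using R finite_subset[of R "{1..l}"] by (intro card_Un_disjoint) auto
    finally show ?thesis by simp
  qed
  \<comment> \<open>Splitting off the deleted positions as a summand makes the subtraction of
    natural numbers exact.\<close>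
  moreover have "pos (u, j, i) = p * (u * r + card {j' \<in> R. j' < j}) +
      (K * \<mu> (index (u, j, i)) + (x0 + card {j' \<in> {1..l} - R. j' < j} * p))"
    by (simp only: pos_def prod.case b) (simp add: algebra_simps)
  ultimately show ?thesis
    using card_preceding[OF R j ui] by (simp add: rank_def)
qed

lemma inj_on_index: "inj_on index (block j)" if "j \<le> l"
proof (rule inj_onI)
  fix q q'
  assume q: "q \<in> block j" "q' \<in> block j" and eq: "index q = index q'"
  obtain u i u' i' where "q = (u, j, i)" "q' = (u', j, i')" using q by (auto simp: block_def)
  then show "q = q'"
    using index_strict_mono[of u u' j j i i'] index_strict_mono[of u' u j j i' i] q eq that
    by (simp add: block_def) (metis less_irrefl linorder_neqE_nat)
qed

lemma block_subset: "j \<in> {1..l} \<Longrightarrow> block j \<subseteq> {..<e} \<times> {1..l} \<times> {..<p}"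
  by (auto simp: block_def)

lemma card_block: "card (block j) = e * p"
  by (simp add: block_def card_cartesian_product)

lemma pos_block_disjoint:
  assumes "j \<in> {1..l}" "j' \<in> {1..l}" "q \<in> block j" "q' \<in> block j'" "pos q = pos q'"
  shows "j = j'"
  using inj_onD[OF inj_on_pos assms(5)] assms block_subset by (auto simp: block_def)

text \<open>These facts let both Ramsey results be applied to a rearrangement: the number of non-1s
  does not depend on the choice of \<open>R\<close>, and \<open>R\<close> affects the rank set of
  block \<open>j\<close> only through the translation.\<close>

lemma rearranged_word_color:
  assumes h: "\<forall>q \<in> {..<e} \<times> {1..l} \<times> {..<p}. pos q < h"
    and R: "R \<subseteq> {1..l}" "card R = r" and j: "j \<in> {1..l} - R"
    and A_def: "A = {..<h} - pos ` (\<Union>j\<in>R. block j)"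
    and Y_def: "Y = \<mu> ` index ` block j"
  shows "pos ` block j \<subseteq> A" "card A = h - r * (e * p)"
    "Y \<subseteq> \<mu> ` {..<e * Suc l * p}" "card Y = e * p"
    "rank A ` pos ` block j = (\<lambda>y. K * y + (x0 + card {j' \<in> {1..l} - R. j' < j} * p)) ` Y"
proof -
  have finR: "finite R" using R finite_subset by blast
  show "pos ` block j \<subseteq> A"
  proof
    fix y assume "y \<in> pos ` block j"
    then obtain q where q: "q \<in> block j" "y = pos q" by blast
    then have "y < h" using bspec[OF h, of q] block_subset[of j] j by blast
    moreover have "y \<notin> pos ` (\<Union>j\<in>R. block j)"
    proof
      assume "y \<in> pos ` (\<Union>j\<in>R. block j)"
      then obtain j' q' where "j' \<in> R" "q' \<in> block j'" "y = pos q'" by blast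
      then show False using pos_block_disjoint[of j j' q q'] q j R by auto
    qed
    ultimately show "y \<in> A" by (simp add: A_def)
  qed
  have UN: "(\<Union>j\<in>R. block j) = {..<e} \<times> R \<times> {..<p}" by (auto simp: block_def)
  have "card (pos ` (\<Union>j\<in>R. block j)) = r * (e * p)"
    using R unfolding UN by (subst card_image[OF inj_on_subset[OF inj_on_pos]]) (auto simp: card_cartesian_product)
  moreover have "pos ` (\<Union>j\<in>R. block j) \<subseteq> {..<h}" using h R unfolding UN by auto
  ultimately show "card A = h - r * (e * p)"
    unfolding A_def by (subst card_Diff_subset) (auto intro: finite_subset)
  have ind: "index ` block j \<subseteq> {..<e * Suc l * p}"
    using j index_less by (auto simp: block_def simp del: mult_Suc_right)
  then show "Y \<subseteq> \<mu> ` {..<e * Suc l * p}" unfolding Y_def by blast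
  have "inj_on \<mu> (index ` block j)"
    using strict_mono_on_imp_inj_on[OF \<mu>_mono] ind by (rule inj_on_subset)
  then show "card Y = e * p"
    using inj_on_index[of j] j by (simp add: Y_def card_image card_block)
  have "rank A (pos q) = K * \<mu> (index q) + (x0 + card {j' \<in> {1..l} - R. j' < j} * p)" if "q \<in> block j" for q
    using that rank_pos[OF h R j] by (auto simp: block_def A_def)
  then show "rank A ` pos ` block j = (\<lambda>y. K * y + (x0 + card {j' \<in> {1..l} - R. j' < j} * p)) ` Y"
    unfolding Y_def image_image by (intro image_cong) auto
qed

text \<open>Selected coordinates outside the blocks are fixed as 2 and all unselected ones as 1.
  Hence the non-1s are exactly the selected coordinates outside the blocks that carry 1s.\<close>

lemma block_word_eq_word123:
  assumes h: "\<forall>q \<in> {..<e} \<times> {1..l} \<times> {..<p}. pos q < h"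
    and g: "inj_on g {..<h}"
    and \<pi>: "\<pi> \<in> words 3 l"
  shows "block_word n l (\<lambda>j. g ` pos ` block j) (\<lambda>x. if x \<in> g ` {..<h} then 2 else 1) \<pi> =
    word123 n (g ` ({..<h} - pos ` (\<Union>j\<in>{j \<in> {1..l}. \<pi> j = 1}. block j)))
              (g ` pos ` (\<Union>j\<in>{j \<in> {1..l}. \<pi> j = 3}. block j))" (is "?lhs = ?rhs")
proof
  fix x
  have gpos: "g (pos q) = g y \<longleftrightarrow> pos q = y" if "q \<in> block j" "j \<in> {1..l}" "y < h" for q j y
    using inj_on_eq_iff[OF g] h block_subset that by blast
  have gpos2: "g (pos q) = g (pos q') \<longleftrightarrow> pos q = pos q'"
    if "q \<in> block j" "j \<in> {1..l}" "q' \<in> block j'" "j' \<in> {1..l}" for q j q' j'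
    using gpos[OF that(1,2)] h block_subset that by blast
  consider (out) "x \<notin> {1..n}" | (blk) j q where "x \<in> {1..n}" "j \<in> {1..l}" "q \<in> block j" "x = g (pos q)"
    | (fixed) "x \<in> {1..n}" "x \<notin> (\<Union>j\<in>{1..l}. g ` pos ` block j)" by blast
  then show "?lhs x = ?rhs x"
  proof cases
    case out
    then show ?thesis by (auto simp: block_word_def word123_def)
  next
    case (blk j q)
    have uniq: "j' = j" if j': "j' \<in> {1..l}" "x \<in> g ` pos ` block j'" for j'
    proof -
      obtain q' where q': "q' \<in> block j'" "x = g (pos q')" using j' by blast
      then have "pos q = pos q'" using gpos2[of q j q' j'] blk that by simp
      then show ?thesis using pos_block_disjoint blk q' that by metis
    qed
    have xj: "x \<in> g ` pos ` block j" using blk(3,4) by blast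
    have "(THE j. j \<in> {1..l} \<and> x \<in> g ` pos ` block j) = j"
    proof (rule the_equality)
      show "j \<in> {1..l} \<and> x \<in> g ` pos ` block j" using blk(2) xj ..
    next
      fix j' assume "j' \<in> {1..l} \<and> x \<in> g ` pos ` block j'"
      then show "j' = j" using uniq by blast
    qed
    moreover have "x \<in> (\<Union>j\<in>{1..l}. g ` pos ` block j)" using blk(2) xj by (rule UN_I)
    ultimately have lhs: "?lhs x = \<pi> j"
      unfolding block_word_def using blk(1) by (simp only: restrict_apply if_True simp_thms)
    have in_value: "x \<in> g ` pos ` (\<Union>j\<in>{j \<in> {1..l}. \<pi> j = v}. block j) \<longleftrightarrow> \<pi> j = v" for v
    proof
      assume "x \<in> g ` pos ` (\<Union>j\<in>{j \<in> {1..l}. \<pi> j = v}. block j)"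
      then obtain j' where j': "j' \<in> {1..l}" "\<pi> j' = v" "x \<in> g ` pos ` block j'" by blast
      then show "\<pi> j = v" using uniq[of j'] by simp
    next
      assume "\<pi> j = v"
      then have "block j \<subseteq> (\<Union>j\<in>{j \<in> {1..l}. \<pi> j = v}. block j)" using blk(2) by blast
      then show "x \<in> g ` pos ` (\<Union>j\<in>{j \<in> {1..l}. \<pi> j = v}. block j)"
        using xj by (meson image_mono subsetD)
    qed
    have "x \<in> g ` ({..<h} - pos ` (\<Union>j\<in>{j \<in> {1..l}. \<pi> j = 1}. block j)) \<longleftrightarrow> \<pi> j \<noteq> 1"
    proof -
      let ?R = "pos ` (\<Union>j\<in>{j \<in> {1..l}. \<pi> j = 1}. block j)"
      have sub: "?R \<subseteq> {..<h}"
      proof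
        fix y assume "y \<in> ?R"
        then obtain j' q' where "j' \<in> {1..l}" "q' \<in> block j'" "y = pos q'" by blast
        then show "y \<in> {..<h}" using bspec[OF h, of q'] block_subset[of j'] by blast
      qed
      then have "g ` ({..<h} - ?R) = g ` {..<h} - g ` ?R"
        using inj_on_image_set_diff[OF g Diff_subset sub] sub by simp
      moreover have "pos q \<in> {..<h}" using bspec[OF h, of q] block_subset[OF blk(2)] blk(3) by blast
      then have "x \<in> g ` {..<h}" using blk(4) by blast
      ultimately show ?thesis using in_value[of 1] by (simp only: Diff_iff simp_thms)
    qed
    moreover have "\<pi> j \<in> {1, 2, 3}" using \<pi> blk by (force simp: words_def PiE_iff)
    ultimately show ?thesis using lhs in_value[of 3] blk(1) by (auto simp: word123_def)
  next
    case fixed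
    have lhs: "?lhs x = (if x \<in> g ` {..<h} then 2 else 1)"
      unfolding block_word_def restrict_apply using fixed by (simp only: if_True if_False simp_thms)
    have not_in: "x \<notin> g ` pos ` (\<Union>j\<in>{j \<in> {1..l}. \<pi> j = v}. block j)" for v
      using fixed(2) by blast
    have "x \<in> g ` ({..<h} - pos ` (\<Union>j\<in>{j \<in> {1..l}. \<pi> j = 1}. block j)) \<longleftrightarrow> x \<in> g ` {..<h}"
      using not_in[of 1] by blast
    with lhs not_in[of 3] fixed(1) show ?thesis
      unfolding word123_def restrict_apply by (simp only: if_True if_False simp_thms)
  qed
qed

end

section \<open>Choice of parameters and construction of the block set\<close>

lemma card_template_123:
  assumes "\<pi> \<in> rearrangements 3 (r + s + 1) (template_123 r s)"
  shows "card {j \<in> {1..r+s+1}. \<pi> j = 1} = r" "card {j \<in> {1..r+s+1}. \<pi> j = 2} = s"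
    "card {j \<in> {1..r+s+1}. \<pi> j = 3} = 1"
proof -
  have "{i \<in> {1..r+s+1}. template_123 r s i = 1} = {1..r}"
    "{i \<in> {1..r+s+1}. template_123 r s i = 2} = {r+1..r+s}"
    "{i \<in> {1..r+s+1}. template_123 r s i = 3} = {r+s+1}"
    by (auto simp: template_123_def split: if_splits)
  then show "card {j \<in> {1..r+s+1}. \<pi> j = 1} = r" "card {j \<in> {1..r+s+1}. \<pi> j = 2} = s"
    "card {j \<in> {1..r+s+1}. \<pi> j = 3} = 1"
    using assms by (simp_all add: rearrangements_def)
qed

theorem theorem3p1:
  fixes r s k :: nat
  assumes "r > 0" and "s > 0" and "k > 0"
  shows "\<exists>n d. n > 0 \<and> d > 0 \<and>
    (\<forall>c \<in> words 3 n \<rightarrow> {1..k}.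
       \<exists>B. is_block_set 3 (r + s + 1) (template_123 r s) n d B \<and> monochromatic c B)"
proof -
  define l where "l = r + s + 1"
  obtain W where W: "\<And>c :: nat \<Rightarrow> nat. c ` {..<W} \<subseteq> {1..k} \<Longrightarrow>
      \<exists>a p. a + s * p < W \<and> p \<le> W \<and> mono_ap c s a p"
    using van_der_Waerden[of "{1..k}" s] by auto
  define d :: nat where "d = fact W"
  have d0: "d > 0" by (simp add: d_def)
  \<comment> \<open>This agrees with the spacing \<open>e * p * l + 1\<close> of the layout for
    whichever \<open>p\<close> arises, since \<open>e * p = d\<close>.\<close>
  define K where "K = d * l + 1"
  have "d \<le> d * Suc l" by simp
  then obtain N where N: "\<And>F :: nat set \<Rightarrow> nat. F ` Pow {..<K * N + W} \<subseteq> {1..k} \<Longrightarrow>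
           (\<exists>M\<subseteq>{..<N}. card M = d * Suc l \<and> (\<exists>G. G ` {..W} \<subseteq> {1..k} \<and>
             (\<forall>Y\<subseteq>M. card Y = d \<longrightarrow> (\<forall>x\<le>W. F ((\<lambda>y. K * y + x) ` Y) = G x))))"
    using translation_Ramsey[of "{1..k}" d "d * Suc l" K W] by (auto simp: K_def)
  \<comment> \<open>The summands of \<open>h\<close> bound those of \<open>pos\<close>:
    \<open>K * N\<close> for the dilated part, \<open>W\<close> for \<open>x0\<close>, and
    \<open>d * l + r * d\<close> for the rest. Deleting \<open>r\<close> blocks of size
    \<open>d\<close> from \<open>h\<close> positions leaves \<open>t\<close>.\<close>
  define t where "t = K * N + W + d * l"
  define h where "h = t + r * d"
  have "t \<le> h" by (simp add: h_def)
  then obtain n where n: "n > 0" "\<And>c. c \<in> words 3 n \<rightarrow> {1..k} \<Longrightarrow>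
       \<exists>g F. strict_mono_on {..<h} g \<and> g ` {..<h} \<subseteq> {1..n} \<and> F ` Pow {..<t} \<subseteq> {1..k} \<and>
           (\<forall>A\<subseteq>{..<h}. card A = t \<longrightarrow> (\<forall>B\<subseteq>A. c (word123 n (g ` A) (g ` B)) = F (rank A ` B)))"
    using pattern_Ramsey[of "{1..k}" t h] by auto
  have "\<exists>B. is_block_set 3 l (template_123 r s) n (l * d) B \<and> monochromatic c B"
    if c: "c \<in> words 3 n \<rightarrow> {1..k}" for c
  proof -
    from n(2)[OF c] obtain g F where "strict_mono_on {..<h} g \<and> g ` {..<h} \<subseteq> {1..n} \<and> F ` Pow {..<t} \<subseteq> {1..k} \<and>
           (\<forall>A\<subseteq>{..<h}. card A = t \<longrightarrow> (\<forall>B\<subseteq>A. c (word123 n (g ` A) (g ` B)) = F (rank A ` B)))"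
      by (elim exE)
    then have g: "strict_mono_on {..<h} g" "g ` {..<h} \<subseteq> {1..n}" and FC: "F ` Pow {..<t} \<subseteq> {1..k}"
      and F: "\<And>A B. A \<subseteq> {..<h} \<Longrightarrow> card A = t \<Longrightarrow> B \<subseteq> A \<Longrightarrow> c (word123 n (g ` A) (g ` B)) = F (rank A ` B)"
      by simp_all
    have injg: "inj_on g {..<h}" using g(1) by (rule strict_mono_on_imp_inj_on)
    have "F ` Pow {..<K * N + W} \<subseteq> F ` Pow {..<t}"
      by (intro image_mono Pow_mono) (auto simp: t_def)
    then obtain M G where M: "M \<subseteq> {..<N}" "card M = d * Suc l" and GC: "G ` {..W} \<subseteq> {1..k}"
      and G: "\<And>Y x. Y \<subseteq> M \<Longrightarrow> card Y = d \<Longrightarrow> x \<le> W \<Longrightarrow> F ((\<lambda>y. K * y + x) ` Y) = G x"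
      using N[of F] FC by (meson order_trans)
    have "finite M" using M finite_subset by blast
    then obtain \<mu> where \<mu>: "bij_betw \<mu> {..<d * Suc l} M" "strict_mono_on {..<d * Suc l} \<mu>"
      using ex_bij_betw_strict_mono_card M by metis
    have "G ` {..<W} \<subseteq> {1..k}" using GC by auto
    then obtain x0 p where ap: "x0 + s * p < W" "p \<le> W" "mono_ap G s x0 p" using W by blast
    have p0: "p > 0" using ap by (simp add: mono_ap_def)
    then have "p dvd d" using ap by (simp add: d_def dvd_fact)
    then obtain e where e: "e * p = d" by (metis dvd_def mult.commute)
    interpret layout e l p K x0 r \<mu>
    proof
      have "e * Suc l * p = d * Suc l" using e by (metis mult.assoc mult.commute)
      then show "strict_mono_on {..<e * Suc l * p} \<mu>" using \<mu> by simp
      show "K = e * p * l + 1" using e by (simp add: K_def)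
    qed
    have el: "e * Suc l * p = d * Suc l" using e by (metis mult.assoc mult.commute)
    have pos_h: "\<forall>q \<in> {..<e} \<times> {1..l} \<times> {..<p}. pos q < h"
    proof
      fix q assume q: "q \<in> {..<e} \<times> {1..l} \<times> {..<p}"
      obtain u j i where uji: "q = (u, j, i)" "u < e" "j \<in> {1..l}" "i < p" using q by auto
      have "index q < e * Suc l * p" using uji index_less by simp
      then have "index q \<in> {..<d * Suc l}" unfolding el by simp
      then have "\<mu> (index q) < N" using bij_betwE[OF \<mu>(1)] M(1) by blast
      then have "K * \<mu> (index q) < K * N" by (rule mult_strict_left_mono) (simp add: K_def)
      moreover have "x0 \<le> W" using ap by simp
      moreover have "p * (u * r + (j - 1)) \<le> r * d + d * l"
      proof -
        have "p * (u * r + (j - 1)) \<le> p * (e * r + e * l)"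
        proof (intro mult_left_mono add_mono mult_right_mono)
          have "j - 1 \<le> 1 * l" using uji by auto
          also have "\<dots> \<le> e * l" using uji by (intro mult_right_mono) auto
          finally show "j - 1 \<le> e * l" .
        qed (use uji in auto)
        then show ?thesis unfolding e[symmetric] by (simp add: algebra_simps)
      qed
      ultimately show "pos q < h" unfolding uji pos_def h_def t_def prod.case by linarith
    qed
    define I where "I j = g ` pos ` block j" for j
    define a where "a x = (if x \<in> g ` {..<h} then 2 else 1 :: nat)" for x
    define B where "B = block_word n l I a ` rearrangements 3 l (template_123 r s)"
    have pos_block: "pos ` block j \<subseteq> {..<h}" if "j \<in> {1..l}" for j
      using pos_h block_subset[OF that] by auto
    have "is_block_set 3 l (template_123 r s) n (l * d) B"
      unfolding is_block_set_def
    proof (intro conjI exI[of _ I] exI[of _ a])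
      show "is_template 3 l (template_123 r s)" using is_template_123 by (simp add: l_def)
      show "\<forall>j\<in>{1..l}. I j \<subseteq> {1..n}" using pos_block g(2) unfolding I_def by blast
      show "disjoint_family_on I {1..l}"
      proof (unfold disjoint_family_on_def, intro ballI impI)
        fix j j' assume j: "j \<in> {1..l}" "j' \<in> {1..l}" "j \<noteq> j'"
        then have "pos ` block j \<inter> pos ` block j' = {}"
          using pos_block_disjoint by blast
        then show "I j \<inter> I j' = {}"
          unfolding I_def using inj_on_image_Int[OF injg] pos_block j by (metis image_empty)
      qed
      show "\<forall>i\<in>{1..n} - (\<Union>j\<in>{1..l}. I j). a i \<in> {1..3}" by (auto simp: a_def)
      have "card (I j) = d" if "j \<in> {1..l}" for j
        using card_image[OF inj_on_subset[OF injg pos_block[OF that]]]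
          card_image[OF inj_on_subset[OF inj_on_pos block_subset[OF that]]]
        by (simp add: I_def card_block e)
      then show "(\<Sum>j\<in>{1..l}. card (I j)) = l * d" by simp
    qed (simp add: B_def)
    moreover have "c (block_word n l I a \<pi>) = G x0"
      if \<pi>: "\<pi> \<in> rearrangements 3 l (template_123 r s)" for \<pi>
    proof -
      define R where "R = {j \<in> {1..l}. \<pi> j = 1}"
      have \<pi>w: "\<pi> \<in> words 3 l" using \<pi> by (simp add: rearrangements_def)
      note cards = card_template_123[OF \<pi>[unfolded l_def], folded l_def]
      obtain j where j: "{j \<in> {1..l}. \<pi> j = 3} = {j}" using cards(3) card_1_singletonE by blast
      then have jR: "j \<in> {1..l} - R" by (auto simp: R_def)
      have R: "R \<subseteq> {1..l}" "card R = r" using cards(1) by (auto simp: R_def)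
      define A where "A = {..<h} - pos ` (\<Union>j\<in>R. block j)"
      define m where "m = card {j' \<in> {1..l} - R. j' < j}"
      define Y where "Y = \<mu> ` index ` block j"
      note layout_facts = rearranged_word_color[OF pos_h R jR A_def Y_def, folded m_def]
      \<comment> \<open>Block \<open>j\<close> is the only one with 3s, so an earlier block without
        1s carries 2s. There are \<open>s\<close> of these, so the translation stays within the
        monochromatic progression.\<close>
      have "{j' \<in> {1..l} - R. j' < j} \<subseteq> {j \<in> {1..l}. \<pi> j = 2}"
      proof
        fix j' assume j': "j' \<in> {j' \<in> {1..l} - R. j' < j}"
        have "\<pi> j' \<in> {1, 2, 3}" using j' \<pi>w by (force simp: words_def PiE_iff)
        moreover have "\<pi> j' \<noteq> 1" using j' unfolding R_def by blast
        moreover have "\<pi> j' \<noteq> 3"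
        proof
          assume "\<pi> j' = 3"
          then have "j' \<in> {j}" using j' unfolding j[symmetric] by blast
          then show False using j' by simp
        qed
        ultimately show "j' \<in> {j \<in> {1..l}. \<pi> j = 2}" using j' by blast
      qed
      then have m: "m \<le> s" unfolding m_def cards(2)[symmetric] by (intro card_mono) auto
      have "block_word n l I a \<pi> = word123 n (g ` A) (g ` pos ` block j)"
        using block_word_eq_word123[OF pos_h injg \<pi>w] unfolding j
        by (simp add: I_def[abs_def] a_def[abs_def] A_def R_def)
      then have "c (block_word n l I a \<pi>) = c (word123 n (g ` A) (g ` pos ` block j))"
        by (rule arg_cong)
      also have "\<dots> = F (rank A ` pos ` block j)"
      proof (rule F)
        show "A \<subseteq> {..<h}" unfolding A_def by blast
        show "card A = t" unfolding layout_facts(2) e by (simp add: h_def)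
      qed (rule layout_facts(1))
      also have "\<dots> = F ((\<lambda>y. K * y + (x0 + m * p)) ` Y)" by (simp only: layout_facts(5))
      also have "\<dots> = G (x0 + m * p)"
      proof (rule G)
        show "Y \<subseteq> M" using layout_facts(3) \<mu>(1) el by (simp add: bij_betw_def)
        show "card Y = d" using layout_facts(4) e by simp
        have "m * p \<le> s * p" using m by simp
        then show "x0 + m * p \<le> W" using ap(1) by linarith
      qed
      also have "\<dots> = G x0" using ap(3) m by (simp add: mono_ap_def)
      finally show ?thesis .
    qed
    then have "monochromatic c B" by (auto simp: Defs.monochromatic_def B_def)
    ultimately show ?thesis by blast
  qed
  moreover have "l * d > 0" using d0 by (simp add: l_def)
  ultimately show ?thesis using n(1) unfolding l_def by blast
qed

end
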